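(* Let $q$ be a positive integer such that $p = 2^q - 1$ and $N = 2^p - 1$ are both (Mersenne) primes. Assume that $\sum_{j=0}^{q-1} 2^{2^j} = 2^1 + 2^{2^1} + 2^{2^2} + \cdots + 2^{2^{q-1}}$ is not divisible by $N$. Let $r$ be the smallest positive integer such that $$\Big(1 + \sum_{j=0}^{q-1} 2^{2^j}\Big) + r \sum_{j=0}^{q-1} 2^{2^j} \equiv 0 \pmod N.$$ Then for all $k = 1, 2, \ldots$ and all $i = 0, 1, 2, \ldots$, $$F_{qk} + F_{qk+1} + \cdots + F_{qk + [q-1 + rq + iq(2^p-1)]} \equiv q - 1 + rq \pmod{2^p - 1},$$ where $F_t = 2^{2^t} + 1$ denotes the $t$-th Fermat number.
   Context: A Mersenne prime is a prime number of the form $2^t - 1$ with $t$ a positive integer. *)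

theory Defs
  imports "HOL-Number_Theory.Number_Theory"
begin

definition mersenne_prime :: "nat \<Rightarrow> bool" where
  "mersenne_prime m \<longleftrightarrow> prime m \<and> (\<exists>t>0. m = 2 ^ t - 1)"

definition fermat_number :: "nat \<Rightarrow> nat" where
  "fermat_number t = 2 ^ (2 ^ t) + 1"

end

theory Submission
  imports Defs
begin

text \<open>
  Modulo \<open>N = 2 ^ p - 1\<close> the order of \<open>2\<close> divides \<open>p = 2 ^ q - 1\<close>, and modulo \<open>p\<close> the order of
  \<open>2\<close> divides \<open>q\<close>. Hence \<open>2 ^ 2 ^ t\<close>, and with it the Fermat number \<open>F t\<close>, depends modulo \<open>N\<close> only
  on \<open>t\<close> modulo \<open>q\<close> (\<open>fermat_number_cong_period\<close>). With \<open>S\<close> the sum of \<open>2 ^ 2 ^ j\<close> over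
  \<open>j < q\<close>, any \<open>q\<close> consecutive Fermat numbers therefore add up to \<open>S + q\<close> modulo \<open>N\<close>.

  The sum in question has \<open>q + r * q + i * q * N\<close> terms, which is a whole number
  \<open>1 + r + i * N\<close> of periods, so it is congruent to \<open>(1 + r) * (S + q)\<close>. The defining congruence
  of \<open>r\<close> says \<open>(1 + r) * S \<equiv> - 1\<close>, and what remains is \<open>(1 + r) * q - 1 = q - 1 + r * q\<close>.
  Such an \<open>r\<close> exists because \<open>S\<close> is invertible modulo the prime \<open>N\<close>
  (\<open>exists_pos_linear_cong_0\<close>).
\<close>

lemma fermat_number_cong_period:
  assumes "p = 2 ^ q - 1" and "N = 2 ^ p - 1"
  shows "[fermat_number (t + q) = fermat_number t] (mod N)"
proof -
  have "[2 ^ p = 1] (mod N)"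
    by (simp add: assms(2) cong_altdef_nat)
  then have "[(2 ^ p) ^ (2 ^ t) * 2 ^ (2 ^ t) = 1 ^ (2 ^ t) * 2 ^ (2 ^ t)] (mod N)"
    by (intro cong_mult cong_pow cong_refl)
  moreover have "2 ^ (t + q) = p * 2 ^ t + (2::nat) ^ t"
    by (simp add: assms(1) power_add algebra_simps)
  ultimately show ?thesis
    unfolding fermat_number_def
    by (intro cong_add cong_refl) (simp only: power_add power_mult power_one mult_1)
qed

lemma cong_add_mult_period:
  fixes f :: "nat \<Rightarrow> nat"
  assumes "\<And>t. [f (t + q) = f t] (mod N)"
  shows "[f (q * k + j) = f j] (mod N)"
proof (induction k)
  case (Suc k)
  have "[f ((q * k + j) + q) = f (q * k + j)] (mod N)"
    by (rule assms)
  with Suc.IH show ?case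
    by (simp add: add_ac) (blast intro: cong_trans)
qed simp

lemma cong_sum_periods:
  fixes f :: "nat \<Rightarrow> nat"
  assumes "\<And>t. [f (t + q) = f t] (mod N)"
  shows "[(\<Sum>j<q * n. f j) = n * (\<Sum>j<q. f j)] (mod N)"
proof (induction n)
  case (Suc n)
  have "(\<Sum>j<q * Suc n. f j) = (\<Sum>j<q * n. f j) + (\<Sum>j<q. f (q * n + j))"
  proof -
    have "(\<Sum>j<m + l. f j) = (\<Sum>j<m. f j) + (\<Sum>j<l. f (m + j))" for m l
      by (induction l) (simp_all add: add_ac)
    from this[of "q * n" q] show ?thesis
      by (simp add: add.commute)
  qed
  moreover have "[(\<Sum>j<q. f (q * n + j)) = (\<Sum>j<q. f j)] (mod N)"
    by (intro cong_sum cong_add_mult_period assms)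
  ultimately have "[(\<Sum>j<q * Suc n. f j) = n * (\<Sum>j<q. f j) + (\<Sum>j<q. f j)] (mod N)"
    by (simp only: cong_add Suc.IH)
  then show ?case
    by (simp add: add.commute)
qed simp

lemma exists_pos_linear_cong_0:
  fixes a b N :: nat
  assumes "coprime a N" and "N > 0"
  shows "\<exists>r>0. [b + r * a = 0] (mod N)"
proof -
  obtain x where x: "[a * x = 1] (mod N)"
    using cong_solve_coprime_nat[OF assms(1)] by auto
  \<comment> \<open>The factor \<open>N - 1\<close> stands for \<open>- 1\<close>; the summand \<open>N\<close> only makes \<open>r\<close> positive.\<close>
  define r where "r = x * ((N - 1) * b) + N"
  have "b + r * a = b + (a * x) * ((N - 1) * b) + N * a"
    unfolding r_def by (simp only: distrib_left distrib_right mult_ac add_ac)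
  also have "[\<dots> = b + (a * x) * ((N - 1) * b)] (mod N)"
    by (simp add: cong_def)
  also have "[b + (a * x) * ((N - 1) * b) = b + 1 * ((N - 1) * b)] (mod N)"
    by (intro cong_add cong_mult cong_refl x)
  also have "b + 1 * ((N - 1) * b) = N * b"
    using assms(2) by (cases N) auto
  also have "[N * b = 0] (mod N)"
    by (simp add: cong_def)
  finally show ?thesis
    using assms(2) by (auto simp: r_def)
qed

theorem corollary3:
  fixes q p N r :: nat
  assumes "q > 0"
    and "p = 2 ^ q - 1"
    and "N = 2 ^ p - 1"
    and "mersenne_prime p"
    and "mersenne_prime N"
    and "\<not> N dvd (\<Sum>j=0..q-1. 2 ^ (2 ^ j))"
    and "r = (LEAST r. r > 0 \<and>
           [(1 + (\<Sum>j=0..q-1. 2 ^ (2 ^ j))) + r * (\<Sum>j=0..q-1. 2 ^ (2 ^ j)) = 0] (mod N))"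
  shows "\<forall>k\<ge>1. \<forall>i.
           [(\<Sum>j=0..(q - 1 + r * q + i * q * (2 ^ p - 1)). fermat_number (q * k + j))
              = q - 1 + r * q] (mod (2 ^ p - 1))"
proof (intro allI impI)
  fix k i :: nat
  define S :: nat where "S = (\<Sum>j=0..q-1. 2 ^ (2 ^ j))"
  define n where "n = 1 + r + i * N"
  have "prime N"
    using assms(5) by (simp add: mersenne_prime_def)
  then have "coprime S N" "N > 0"
    using assms(6) prime_imp_coprime[of N S]
    by (auto simp: S_def coprime_commute prime_gt_0_nat)
  then have "\<exists>r. r > 0 \<and> [(1 + S) + r * S = 0] (mod N)"
    using exists_pos_linear_cong_0 by blast
  then have r: "[(1 + S) + r * S = 0] (mod N)"
    unfolding assms(7) S_def[symmetric] by (rule LeastI2_ex) simp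
  note period = fermat_number_cong_period[OF assms(2,3)]
  have "{0..q-1} = {..<q}"
    using assms(1) by auto
  then have one_period: "(\<Sum>j<q. fermat_number j) = S + q"
    unfolding S_def fermat_number_def by (simp only: sum.distrib) simp
  have "{0..q - 1 + r * q + i * q * N} = {..<q * n}"
    using assms(1) by (auto simp: n_def algebra_simps)
  then have "[(\<Sum>j=0..q - 1 + r * q + i * q * N. fermat_number (q * k + j))
      = (\<Sum>j<q * n. fermat_number j)] (mod N)"
    by (simp only:) (intro cong_sum cong_add_mult_period period)
  also have "[(\<Sum>j<q * n. fermat_number j) = n * (S + q)] (mod N)"
    using cong_sum_periods[of fermat_number, OF period, of n] by (simp only: one_period)
  also have "[n * (S + q) = q - 1 + r * q] (mod N)"
  proof -
    \<comment> \<open>Adding \<open>1\<close> to both sides avoids the negative residue \<open>(1 + r) * S \<equiv> - 1\<close>.\<close>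
    have "n * (S + q) + 1 = ((1 + S) + r * S) + (q + r * q) + N * (i * (S + q))"
      by (simp add: n_def algebra_simps)
    also have "[\<dots> = 0 + (q + r * q) + 0] (mod N)"
      by (intro cong_add r cong_refl) (simp add: cong_def)
    also have "0 + (q + r * q) + 0 = (q - 1 + r * q) + 1"
      using assms(1) by simp
    finally show ?thesis
      by (simp only: cong_add_rcancel_nat)
  qed
  finally show "[(\<Sum>j=0..(q - 1 + r * q + i * q * (2 ^ p - 1)). fermat_number (q * k + j))
      = q - 1 + r * q] (mod (2 ^ p - 1))"
    by (simp only: assms(3))
qed

end
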